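(* The satisfiability problem of the logic $\mathrm{XTN}$ is undecidable: there is no algorithm that, given an $\mathrm{XTN}$ formula $\phi$, decides whether there exists an $\mathrm{XTN}$ structure $S$ with $S,0\models\phi$.
   Context: Fix an infinitesimal $\varepsilon>0$ (a non-standard number that is positive and smaller than every positive real). The time domain is $T=\{v+k\varepsilon : v,k\in\mathbb{N}\}$, totally ordered in the natural way; an element $v+k\varepsilon$ is called standard iff $k=0$, and non-standard otherwise. Let $AP$ be a finite set of propositional letters. An $\mathrm{XTN}$ structure is a triple $S=\langle T,\beta,\sigma\rangle$ where $\beta:T\to 2^{AP}$ and $\sigma=(\sigma_i)_i$ (the history) is a finite or infinite sequence of elements of $T$ with $\sigma_0=0$, $\sigma_j<\sigma_i$ whenever $j<i$, and $\beta(t)=\beta(\sigma_i)$ whenever $\sigma_i<t<\sigma_{i+1}$. $\mathrm{XTN}$ formulas are given by the grammar $\phi ::= p \mid \neg\phi \mid \phi_1\wedge\phi_2 \mid \mathrm{Dist}(\phi,1)\mid \mathrm{Dist}(\phi,-1)\mid \mathrm{Dist}(\phi,\varepsilon)\mid \mathrm{Until}(\phi_1,\phi_2)\mid \mathrm{Since}(\phi_1,\phi_2)\mid \mathbf{X}_{st}\phi\mid \mathbf{X}_{ns}\phi\mid \mathrm{NowST}$, with $p\in AP$. Satisfaction at an instant $i\in T$: $S,i\models p$ iff $p\in\beta(i)$; Boolean connectives as usual; $S,i\models\mathrm{Dist}(\phi,d)$ iff $i+d\in T$ and $S,i+d\models\phi$; $S,i\models\mathrm{Until}(\phi,\psi)$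 iff there is $d\ge 0$ with $i+d\in T$, $S,i+d\models\psi$, and $S,i+v\models\phi$ for all $v$ with $0\le v<d$ and $i+v\in T$; $S,i\models\mathrm{Since}(\phi,\psi)$ iff there is $d\ge0$ with $i-d\in T$, $S,i-d\models\psi$, and $S,i+v\models\phi$ for all $v$ with $-d<v\le 0$ and $i+v\in T$; $S,i\models\mathbf{X}_{st}\phi$ iff there is $j$ with $\sigma_j\le i<\sigma_{j+1}$, $\sigma_{j+1}$ standard, and $S,\sigma_{j+1}\models\phi$; $S,i\models\mathbf{X}_{ns}\phi$ iff there is $j$ with $\sigma_j\le i<\sigma_{j+1}$, $\sigma_{j+1}$ non-standard, and $S,\sigma_{j+1}\models\phi$; $S,i\models\mathrm{NowST}$ iff $i$ is standard. A formula $\phi$ is satisfiable iff some structure $S$ has $S,0\models\phi$. *)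

theory Defs
  imports Complex_Main "HOL-Library.Nat_Bijection" "HOL-Library.Extended_Nat"
begin

section \<open>Formulas\<close>

datatype disp = One | MinusOne | Eps

datatype (atoms: 'p) xtn =
    Atom 'p
  | Neg "'p xtn"
  | Conj "'p xtn" "'p xtn"
  | Dist "'p xtn" disp
  | Until "'p xtn" "'p xtn"
  | Since "'p xtn" "'p xtn"
  | Xst "'p xtn"
  | Xns "'p xtn"
  | NowST


section \<open>Time domain and structures\<close>

text \<open>
  Times and displacements live in an arbitrary ordered field extension \<open>'a\<close> of the reals
  (for example the hyperreals); \<open>e\<close> is the infinitesimal.
\<close>

definition time_dom :: "'a::linordered_field \<Rightarrow> 'a set" where
  "time_dom e = {of_nat v + of_nat k * e | v k. True}"

definition standard :: "'a::linordered_field \<Rightarrow> bool" where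
  "standard t \<longleftrightarrow> (\<exists>v. t = of_nat v)"

definition disp_val :: "'a::linordered_field \<Rightarrow> disp \<Rightarrow> 'a" where
  "disp_val e d = (case d of One \<Rightarrow> 1 | MinusOne \<Rightarrow> - 1 | Eps \<Rightarrow> e)"

text \<open>
  The history is the sequence of all \<open>hist S i\<close> with \<open>enat i < hlen S\<close>; it is infinite
  iff \<open>hlen S = \<infinity>\<close>. Values of \<open>hist S\<close> at other indices, and of \<open>beta S\<close> outside the time
  domain, are irrelevant.
\<close>

record ('a, 'p) xtn_struct =
  beta :: "'a \<Rightarrow> 'p set"
  hist :: "nat \<Rightarrow> 'a"
  hlen :: enat

definition is_xtn_struct ::
  "'a::linordered_field \<Rightarrow> 'p set \<Rightarrow> ('a, 'p) xtn_struct \<Rightarrow> bool" where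
  "is_xtn_struct e AP S \<longleftrightarrow>
     (\<forall>t \<in> time_dom e. beta S t \<subseteq> AP) \<and>
     0 < hlen S \<and>
     (\<forall>i. enat i < hlen S \<longrightarrow> hist S i \<in> time_dom e) \<and>
     hist S 0 = 0 \<and>
     (\<forall>i j. enat i < hlen S \<longrightarrow> j < i \<longrightarrow> hist S j < hist S i) \<and>
     (\<forall>i. enat (Suc i) < hlen S \<longrightarrow>
        (\<forall>t \<in> time_dom e. hist S i < t \<longrightarrow> t < hist S (Suc i) \<longrightarrow> beta S t = beta S (hist S i)))"


section \<open>Satisfaction\<close>

primrec sat :: "'a::linordered_field \<Rightarrow> ('a, 'p) xtn_struct \<Rightarrow> 'a \<Rightarrow> 'p xtn \<Rightarrow> bool" where
  "sat e S i (Atom p) \<longleftrightarrow> p \<in> beta S i"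
| "sat e S i (Neg \<phi>) \<longleftrightarrow> \<not> sat e S i \<phi>"
| "sat e S i (Conj \<phi> \<psi>) \<longleftrightarrow> sat e S i \<phi> \<and> sat e S i \<psi>"
| "sat e S i (Dist \<phi> d) \<longleftrightarrow>
     i + disp_val e d \<in> time_dom e \<and> sat e S (i + disp_val e d) \<phi>"
| "sat e S i (Until \<phi> \<psi>) \<longleftrightarrow>
     (\<exists>d \<ge> 0. i + d \<in> time_dom e \<and> sat e S (i + d) \<psi> \<and>
        (\<forall>v. 0 \<le> v \<and> v < d \<and> i + v \<in> time_dom e \<longrightarrow> sat e S (i + v) \<phi>))"
| "sat e S i (Since \<phi> \<psi>) \<longleftrightarrow>
     (\<exists>d \<ge> 0. i - d \<in> time_dom e \<and> sat e S (i - d) \<psi> \<and>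
        (\<forall>v. - d < v \<and> v \<le> 0 \<and> i + v \<in> time_dom e \<longrightarrow> sat e S (i + v) \<phi>))"
| "sat e S i (Xst \<phi>) \<longleftrightarrow>
     (\<exists>j. enat (Suc j) < hlen S \<and> hist S j \<le> i \<and> i < hist S (Suc j) \<and>
        standard (hist S (Suc j)) \<and> sat e S (hist S (Suc j)) \<phi>)"
| "sat e S i (Xns \<phi>) \<longleftrightarrow>
     (\<exists>j. enat (Suc j) < hlen S \<and> hist S j \<le> i \<and> i < hist S (Suc j) \<and>
        \<not> standard (hist S (Suc j)) \<and> sat e S (hist S (Suc j)) \<phi>)"
| "sat e S i NowST \<longleftrightarrow> standard i"

definition xtn_satisfiable :: "'a::linordered_field \<Rightarrow> 'p set \<Rightarrow> 'p xtn \<Rightarrow> bool" where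
  "xtn_satisfiable e AP \<phi> \<longleftrightarrow> (\<exists>S. is_xtn_struct e AP S \<and> sat e S 0 \<phi>)"


section \<open>Algorithms\<close>

text \<open>
  Algorithms are Minsky register machines with arbitrarily many registers.
  \<open>Inc r l\<close> increments register \<open>r\<close> and continues at \<open>l\<close>;
  \<open>Dec r l l'\<close> decrements \<open>r\<close> and continues at \<open>l\<close> if \<open>r\<close> is nonzero, and continues at \<open>l'\<close>
  otherwise. A machine halts when it leaves its program. Input and output are in register 0.
\<close>

datatype instr = Inc nat nat | Dec nat nat nat

fun rm_step :: "instr list \<Rightarrow> nat \<times> (nat \<Rightarrow> nat) \<Rightarrow> nat \<times> (nat \<Rightarrow> nat)" where
  "rm_step P (pc, R) =
     (if pc < length P then
        (case P ! pc of
           Inc r l \<Rightarrow> (l, R(r := R r + 1))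
         | Dec r l l' \<Rightarrow> (if R r = 0 then (l', R) else (l, R(r := R r - 1))))
      else (pc, R))"

definition rm_computes :: "instr list \<Rightarrow> nat \<Rightarrow> nat \<Rightarrow> bool" where
  "rm_computes P x y \<longleftrightarrow>
     (\<exists>n pc R. (rm_step P ^^ n) (0, (\<lambda>_. 0)(0 := x)) = (pc, R) \<and> length P \<le> pc \<and> R 0 = y)"

text \<open>
  The decision problem with instances \<open>D\<close>, presented through the numbering \<open>code\<close>, and
  question \<open>Q\<close>. Nothing is required of the machine on numbers that do not code an instance.
\<close>

definition decidable_problem :: "('i \<Rightarrow> nat) \<Rightarrow> 'i set \<Rightarrow> ('i \<Rightarrow> bool) \<Rightarrow> bool" where
  "decidable_problem code D Q \<longleftrightarrow>
     (\<exists>P. \<forall>x \<in> D. rm_computes P (code x) (if Q x then 1 else 0))"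

primrec xtn_code :: "nat xtn \<Rightarrow> nat" where
  "xtn_code (Atom p) = prod_encode (0, p)"
| "xtn_code (Neg \<phi>) = prod_encode (1, xtn_code \<phi>)"
| "xtn_code (Conj \<phi> \<psi>) = prod_encode (2, prod_encode (xtn_code \<phi>, xtn_code \<psi>))"
| "xtn_code (Dist \<phi> d) =
     prod_encode (case d of One \<Rightarrow> 3 | MinusOne \<Rightarrow> 4 | Eps \<Rightarrow> 5, xtn_code \<phi>)"
| "xtn_code (Until \<phi> \<psi>) = prod_encode (6, prod_encode (xtn_code \<phi>, xtn_code \<psi>))"
| "xtn_code (Since \<phi> \<psi>) = prod_encode (7, prod_encode (xtn_code \<phi>, xtn_code \<psi>))"
| "xtn_code (Xst \<phi>) = prod_encode (8, xtn_code \<phi>)"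
| "xtn_code (Xns \<phi>) = prod_encode (9, xtn_code \<phi>)"
| "xtn_code NowST = prod_encode (10, 0)"

lemma inj_xtn_code: "inj xtn_code"
proof (rule injI)
  fix \<phi> \<psi> :: "nat xtn"
  show "xtn_code \<phi> = xtn_code \<psi> \<Longrightarrow> \<phi> = \<psi>"
    by (induction \<phi> arbitrary: \<psi>; case_tac \<psi>) (auto split: disp.splits)
qed

end

theory Submission
  imports Defs
begin

text \<open>
  Since \<open>AP\<close> may be empty, the reduction uses the history alone. If the history consists of the points
  \<open>v\<close> and \<open>v + c v \<cdot> \<epsilon>\<close> for all \<open>v\<close>, then the formula saying that the next history point is
  non-standard marks exactly the first \<open>c v\<close> points of the block \<open>{v + k \<cdot> \<epsilon> | k}\<close>. A structure is thus
  a sequence of counters, and the displacements \<open>1\<close> and \<open>\<epsilon>\<close> can state that counters in blocks at a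
  fixed distance are equal or differ by one. Storing the program counter and the registers of a
  configuration in consecutive blocks, one obtains for every register machine \<open>M\<close> a formula \<open>\<psi>\<close> such
  that \<open>\<iota> p \<and> \<psi>\<close> is satisfiable iff \<open>M\<close> does not halt on input \<open>p\<close>, where \<open>\<iota> p\<close> consists of \<open>p\<close>
  displacements by \<open>\<epsilon>\<close> applied to a formula that does not depend on \<open>M\<close>.

  From a decider one builds a machine \<open>M\<close> that on input \<open>p\<close> computes the code of the conjunction of
  \<open>\<iota> p\<close> with the formula coded by \<open>p\<close> itself, and halts iff the decider answers that this conjunction
  is satisfiable. No decoding is needed, because the code of a conjunction is computed from the codes
  of its parts. On the code of its own \<open>\<psi>\<close> the machine \<open>M\<close> halts iff it does not halt.
\<close>

section \<open>Points of the time domain\<close>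

locale infinitesimal =
  fixes e :: "'a::linordered_field"
  assumes e_pos: "0 < e" and e_small: "of_nat n * e < 1"
begin

definition pt :: "nat \<Rightarrow> nat \<Rightarrow> 'a" where
  "pt v k = of_nat v + of_nat k * e"

text \<open>No multiple of \<open>e\<close> reaches the next natural number, so points are ordered
  lexicographically: first by block, then by offset inside it.\<close>

lemma pt_less_of_less: "v < w \<Longrightarrow> pt v k < pt w l"
proof -
  assume "v < w"
  then have "of_nat (Suc v) \<le> (of_nat w :: 'a)"
    by (simp only: of_nat_le_iff Suc_le_eq)
  moreover have "0 \<le> of_nat l * e"
    using e_pos by simp
  ultimately show ?thesis
    using e_small[of k] unfolding pt_def by simp
qed

lemma pt_less_same: "pt v k < pt v l \<longleftrightarrow> k < l"
  using e_pos by (simp add: pt_def)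

lemma pt_less_iff [simp]: "pt v k < pt w l \<longleftrightarrow> v < w \<or> v = w \<and> k < l"
  using pt_less_of_less[of v w k l] pt_less_of_less[of w v l k] pt_less_same[of v k l]
  by (metis linorder_neqE_nat order.asym)

lemma pt_eq_iff [simp]: "pt v k = pt w l \<longleftrightarrow> v = w \<and> k = l"
  by (metis linorder_neqE_nat order.irrefl pt_less_iff)

lemma pt_le_iff [simp]: "pt v k \<le> pt w l \<longleftrightarrow> v < w \<or> v = w \<and> k \<le> l"
  by (auto simp: order.order_iff_strict)

lemma pt_0: "pt 0 0 = 0"
  by (simp add: pt_def)

lemma pt_nonneg: "0 \<le> pt v k"
  by (auto simp flip: pt_0)

lemma standard_pt [simp]: "standard (pt v k) \<longleftrightarrow> k = 0"
proof -
  have "standard (pt v k) \<longleftrightarrow> (\<exists>w. pt v k = pt w 0)"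
    by (simp add: standard_def pt_def)
  then show ?thesis by simp
qed

lemma time_dom_iff: "t \<in> time_dom e \<longleftrightarrow> (\<exists>v k. t = pt v k)"
  by (simp add: time_dom_def pt_def)

lemma pt_in_time_dom [simp]: "pt v k \<in> time_dom e"
  by (auto simp: time_dom_iff)

end


section \<open>Derived connectives\<close>

definition Truth :: "nat xtn" where
  "Truth = Neg (Conj NowST (Neg NowST))"

definition Imp :: "nat xtn \<Rightarrow> nat xtn \<Rightarrow> nat xtn" where
  "Imp \<phi> \<psi> = Neg (Conj \<phi> (Neg \<psi>))"

definition Iff :: "nat xtn \<Rightarrow> nat xtn \<Rightarrow> nat xtn" where
  "Iff \<phi> \<psi> = Conj (Imp \<phi> \<psi>) (Imp \<psi> \<phi>)"

definition Conjs :: "nat xtn list \<Rightarrow> nat xtn" where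
  "Conjs \<phi>s = foldr Conj \<phi>s Truth"

definition Always :: "nat xtn \<Rightarrow> nat xtn" where
  "Always \<phi> = Neg (Until Truth (Neg \<phi>))"

text \<open>Looking back over non-standard points ends at the nearest standard one, the start of the
  current block. Facts about whole blocks can thus be stated at any offset.\<close>

definition AtStart :: "nat xtn \<Rightarrow> nat xtn" where
  "AtStart \<phi> = Since (Neg NowST) (Conj NowST \<phi>)"

definition Fwd :: "nat \<Rightarrow> nat xtn \<Rightarrow> nat xtn" where
  "Fwd n = (\<lambda>\<phi>. Dist \<phi> One) ^^ n"

definition Up :: "nat \<Rightarrow> nat xtn \<Rightarrow> nat xtn" where
  "Up n = (\<lambda>\<phi>. Dist \<phi> Eps) ^^ n"

text \<open>With the history \<open>0, c 0 \<cdot> \<epsilon>, 1, 1 + c 1 \<cdot> \<epsilon>, \<dots>\<close>, where every \<open>c v\<close> is positive, \<open>More\<close> holds at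
  \<open>v + k \<cdot> \<epsilon>\<close> iff \<open>k < c v\<close>.\<close>

definition More :: "nat xtn" where
  "More = Xns (Neg NowST)"

text \<open>In a block where \<open>More\<close> holds exactly at the offsets below c, this marks
  offset c - 1; so \<open>Up q Last\<close>, read at a block start, says that the counter is q +
  1.\<close>

definition Last :: "nat xtn" where
  "Last = Conj More (Dist (Neg More) Eps)"

lemma atoms_Conjs: "atoms (Conjs \<phi>s) = (\<Union>\<phi> \<in> set \<phi>s. atoms \<phi>)"
  by (induction \<phi>s) (auto simp: Conjs_def Truth_def)

lemma atoms_Fwd: "atoms (Fwd n \<phi>) = atoms \<phi>"
  by (induction n) (auto simp: Fwd_def)

lemma atoms_Up: "atoms (Up n \<phi>) = atoms \<phi>"
  by (induction n) (auto simp: Up_def)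

lemmas atoms_derived =
  atoms_Conjs atoms_Fwd atoms_Up Truth_def Imp_def Iff_def Always_def AtStart_def More_def Last_def

lemma sat_Truth [simp]: "sat e S t Truth"
  by (simp add: Truth_def)

lemma sat_Imp [simp]: "sat e S t (Imp \<phi> \<psi>) \<longleftrightarrow> (sat e S t \<phi> \<longrightarrow> sat e S t \<psi>)"
  by (simp add: Imp_def)

lemma sat_Iff [simp]: "sat e S t (Iff \<phi> \<psi>) \<longleftrightarrow> (sat e S t \<phi> \<longleftrightarrow> sat e S t \<psi>)"
  by (auto simp: Iff_def)

lemma sat_Conjs [simp]: "sat e S t (Conjs \<phi>s) \<longleftrightarrow> (\<forall>\<phi> \<in> set \<phi>s. sat e S t \<phi>)"
  by (induction \<phi>s) (auto simp: Conjs_def)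

section \<open>Satisfaction at points, and structures built from counters\<close>

context infinitesimal
begin

definition more :: "('a, nat) xtn_struct \<Rightarrow> nat \<Rightarrow> nat \<Rightarrow> bool" where
  "more S v k \<longleftrightarrow> sat e S (pt v k) More"

lemma sat_More [simp]: "sat e S (pt v k) More \<longleftrightarrow> more S v k"
  by (simp add: more_def)

lemma pt_add_One [simp]: "pt v k + disp_val e One = pt (Suc v) k"
  by (simp add: disp_val_def pt_def)

lemma pt_add_Eps [simp]: "pt v k + disp_val e Eps = pt v (Suc k)"
  by (simp add: disp_val_def pt_def algebra_simps)

text \<open>All of block 0 lies below 1, hence a displacement by -1 leaves the time domain exactly
  there. This lets \<open>Dist Truth MinusOne\<close> tell block 0 from the others.\<close>

lemma pt_add_MinusOne_in_time_dom [simp]: "pt v k + disp_val e MinusOne \<in> time_dom e \<longleftrightarrow> v \<noteq> 0"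
proof (cases v)
  case 0
  have "pt 0 k - 1 < 0"
    using e_small[of k] by (simp add: pt_def)
  then have "pt 0 k - 1 \<notin> time_dom e"
    using pt_nonneg by (metis leD time_dom_iff)
  then show ?thesis using 0 by (simp add: disp_val_def)
next
  case (Suc w)
  then have "pt v k - 1 = pt w k"
    by (simp add: pt_def)
  then show ?thesis using Suc by (simp add: disp_val_def)
qed

lemma sat_Fwd [simp]: "sat e S (pt v k) (Fwd n \<phi>) \<longleftrightarrow> sat e S (pt (v + n) k) \<phi>"
  by (induction n arbitrary: v) (simp_all add: Fwd_def)

lemma sat_Up [simp]: "sat e S (pt v k) (Up n \<phi>) \<longleftrightarrow> sat e S (pt v (k + n)) \<phi>"
  by (induction n arbitrary: k) (simp_all add: Up_def)

lemma sat_Last [simp]: "sat e S (pt v k) Last \<longleftrightarrow> more S v k \<and> \<not> more S v (Suc k)"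
  by (simp add: Last_def)

lemma sat_Always [simp]: "sat e S (pt 0 0) (Always \<phi>) \<longleftrightarrow> (\<forall>v k. sat e S (pt v k) \<phi>)"
  using pt_nonneg by (simp add: Always_def pt_0 time_dom_iff) blast

lemma sat_AtStart [simp]: "sat e S (pt v k) (AtStart \<phi>) \<longleftrightarrow> sat e S (pt v 0) \<phi>"
proof
  assume "sat e S (pt v k) (AtStart \<phi>)"
  then obtain d where d: "0 \<le> d" "pt v k - d \<in> time_dom e" "standard (pt v k - d)"
      "sat e S (pt v k - d) \<phi>"
    and between: "\<And>u. - d < u \<Longrightarrow> u \<le> 0 \<Longrightarrow> pt v k + u \<in> time_dom e \<Longrightarrow> \<not> standard (pt v k + u)"
    by (auto simp: AtStart_def)
  then obtain w where w: "pt v k - d = pt w 0"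
    by (auto simp: time_dom_iff)
  have "pt w 0 \<le> pt v k"
    using d(1) w by (metis diff_ge_0_iff_ge diff_diff_eq2 add_diff_cancel_left' add.commute)
  then have "w \<le> v" by auto
  \<comment> \<open>Otherwise the standard point \<open>pt v 0\<close> would lie strictly after the
    witness, where \<open>Since\<close> demands non-standard points.\<close>
  moreover have False if "w < v"
  proof -
    have "- d < pt v 0 - pt v k"
      using w that pt_less_iff[of w 0 v 0] by (simp add: algebra_simps)
    moreover have "pt v 0 - pt v k \<le> 0"
      by simp
    ultimately show False
      using between[of "pt v 0 - pt v k"] by simp
  qed
  ultimately have "w = v" by force
  then show "sat e S (pt v 0) \<phi>" using d w by simp
next
  assume *: "sat e S (pt v 0) \<phi>"
  have "\<not> standard (pt v k + u)"
    if u: "- (pt v k - pt v 0) < u" "u \<le> 0" "pt v k + u \<in> time_dom e" for u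
  proof -
    obtain w l where wl: "pt v k + u = pt w l"
      using u by (auto simp: time_dom_iff)
    then have "pt v 0 < pt w l" "pt w l \<le> pt v k"
      using u by (simp_all add: algebra_simps flip: wl)
    then show ?thesis by (auto simp: wl)
  qed
  then show "sat e S (pt v k) (AtStart \<phi>)"
    using * by (auto simp: AtStart_def intro!: exI[of _ "pt v k - pt v 0"])
qed

definition counter_struct :: "(nat \<Rightarrow> nat) \<Rightarrow> ('a, nat) xtn_struct" where
  "counter_struct c =
     \<lparr>beta = \<lambda>_. {}, hist = \<lambda>i. pt (i div 2) (if even i then 0 else c (i div 2)), hlen = \<infinity>\<rparr>"

lemma is_xtn_struct_counter_struct:
  assumes "\<And>v. 0 < c v"
  shows "is_xtn_struct e AP (counter_struct c)"
proof -
  have "i div 2 < j div 2 \<or> i div 2 = j div 2 \<and> even i \<and> odd j" if "i < j" for i j :: nat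
    using that by presburger
  then show ?thesis
    using assms by (fastforce simp: is_xtn_struct_def counter_struct_def pt_0)
qed

lemma more_counter_struct:
  assumes "\<And>v. 0 < c v"
  shows "more (counter_struct c) v k \<longleftrightarrow> k < c v"
proof
  assume "more (counter_struct c) v k"
  then obtain j where j: "hist (counter_struct c) j \<le> pt v k" "pt v k < hist (counter_struct c) (Suc j)"
    "\<not> standard (hist (counter_struct c) (Suc j))"
    by (auto simp: more_def More_def)
  \<comment> \<open>Even history indices carry standard points, so \<open>Suc j\<close> is odd and
    both history points lie in one block.\<close>
  then have "even j"
    by (auto simp: counter_struct_def split: if_splits)
  then show "k < c v"
    using j by (auto simp: counter_struct_def)
next
  assume "k < c v"
  then show "more (counter_struct c) v k"
    using assms[of v] unfolding more_def More_def
    by (auto simp: counter_struct_def intro!: exI[of _ "2 * v"])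
qed

end


section \<open>Loop programs\<close>

datatype com = INC nat | SEQ com com | LOOP nat com

inductive exec :: "com \<Rightarrow> (nat \<Rightarrow> nat) \<Rightarrow> (nat \<Rightarrow> nat) \<Rightarrow> bool" where
  exec_INC: "R' = R(r := Suc (R r)) \<Longrightarrow> exec (INC r) R R'"
| exec_SEQ: "exec c R R' \<Longrightarrow> exec d R' R'' \<Longrightarrow> exec (SEQ c d) R R''"
| exec_LOOP_0: "R r = 0 \<Longrightarrow> exec (LOOP r c) R R"
| exec_LOOP_Suc: "R r = Suc n \<Longrightarrow> exec c (R(r := n)) R' \<Longrightarrow> exec (LOOP r c) R' R'' \<Longrightarrow>
    exec (LOOP r c) R R''"

primrec size_com :: "com \<Rightarrow> nat" where
  "size_com (INC r) = 1"
| "size_com (SEQ c d) = size_com c + size_com d"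
| "size_com (LOOP r c) = Suc (size_com c)"

text \<open>The code is placed at address \<open>s\<close> and continues at label \<open>x\<close>; passing the exit label down makes
  an unconditional jump at the end of a loop unnecessary.\<close>

primrec compile :: "com \<Rightarrow> nat \<Rightarrow> nat \<Rightarrow> instr list" where
  "compile (INC r) s x = [Inc r x]"
| "compile (SEQ c d) s x = compile c s (s + size_com c) @ compile d (s + size_com c) x"
| "compile (LOOP r c) s x = Dec r (Suc s) x # compile c (Suc s) s"

lemma length_compile [simp]: "length (compile c s x) = size_com c"
  by (induction c arbitrary: s x) auto

definition code_at :: "instr list \<Rightarrow> nat \<Rightarrow> instr list \<Rightarrow> bool" where
  "code_at M s C \<longleftrightarrow> (\<exists>A B. M = A @ C @ B \<and> length A = s)"

lemma code_at_append:
  assumes "code_at M s (C @ D)"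
  shows "code_at M s C" "code_at M (s + length C) D"
proof -
  obtain A B where M: "M = A @ (C @ D) @ B" "length A = s"
    using assms by (auto simp: code_at_def)
  then show "code_at M s C"
    unfolding code_at_def by (intro exI[of _ A] exI[of _ "D @ B"]) simp
  show "code_at M (s + length C) D"
    using M unfolding code_at_def by (intro exI[of _ "A @ C"] exI[of _ B]) simp
qed

lemma code_at_nth:
  assumes "code_at M s C" "i < length C"
  shows "s + i < length M" "M ! (s + i) = C ! i"
  using assms by (auto simp: code_at_def nth_append)

lemma code_at_Cons:
  assumes "code_at M s (i # C)"
  shows "s < length M" "M ! s = i" "code_at M (Suc s) C"
  using code_at_nth[OF assms, of 0] code_at_append(2)[of M s "[i]" C] assms by simp_all

definition reaches :: "instr list \<Rightarrow> nat \<times> (nat \<Rightarrow> nat) \<Rightarrow> nat \<times> (nat \<Rightarrow> nat) \<Rightarrow> bool" where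
  "reaches M a b \<longleftrightarrow> (\<exists>n. (rm_step M ^^ n) a = b)"

lemma reaches_refl: "reaches M a a"
  unfolding reaches_def by (intro exI[of _ 0]) simp

lemma reaches_trans: "reaches M a b \<Longrightarrow> reaches M b c \<Longrightarrow> reaches M a c"
  unfolding reaches_def by (elim exE, rule_tac x = "na + n" in exI) (simp add: funpow_add)

lemma reaches_step: "rm_step M a = b \<Longrightarrow> reaches M a b"
  unfolding reaches_def by (intro exI[of _ 1]) simp

lemma reaches_compile:
  assumes "exec c R R'" "code_at M s (compile c s x)"
  shows "reaches M (s, R) (x, R')"
  using assms
proof (induction arbitrary: s x rule: exec.induct)
  case (exec_INC R' R r)
  then show ?case using code_at_Cons(1,2)[of M s] by (intro reaches_step) (simp add: fun_upd_def)
next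
  case (exec_SEQ c R R' d R'')
  then show ?case
    using code_at_append by (fastforce intro: reaches_trans)
next
  case (exec_LOOP_0 R r c)
  then show ?case using code_at_Cons(1,2)[of M s] by (intro reaches_step) (simp add: fun_upd_def)
next
  case (exec_LOOP_Suc R r n c R' R'')
  have "code_at M s (Dec r (Suc s) x # compile c (Suc s) s)"
    using exec_LOOP_Suc.prems by simp
  note code = code_at_Cons[OF this]
  have "reaches M (s, R) (Suc s, R(r := n))"
    using code exec_LOOP_Suc.hyps(1) by (intro reaches_step) simp
  then show ?case
    using exec_LOOP_Suc.IH(1)[OF code(3)] exec_LOOP_Suc.IH(2)[OF exec_LOOP_Suc.prems] reaches_trans
    by blast
qed

text \<open>The continuation \<open>c\<close> serves the case of zero increments, since
  \<open>com\<close> has no empty command.\<close>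

primrec incs :: "nat \<Rightarrow> nat \<Rightarrow> com \<Rightarrow> com" where
  "incs 0 r c = c"
| "incs (Suc n) r c = SEQ (INC r) (incs n r c)"

lemma exec_incs: "exec c (R(r := R r + n)) R' \<Longrightarrow> exec (incs n r c) R R'"
proof (induction n arbitrary: R)
  case (Suc n)
  show ?case
    unfolding incs.simps
    by (rule exec_SEQ[OF exec_INC[OF refl]], rule Suc.IH)
      (use Suc.prems in \<open>simp del: fun_upd_apply add: fun_upd_same\<close>)
qed simp

definition move :: "nat \<Rightarrow> nat \<Rightarrow> com" where
  "move a b = LOOP a (INC b)"

definition move2 :: "nat \<Rightarrow> nat \<Rightarrow> nat \<Rightarrow> com" where
  "move2 a b c = LOOP a (SEQ (INC b) (INC c))"

text \<open>A loop body may refill its own loop register. Each round lowers \<open>a\<close> from n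
  + 1 to n, adds n + 1 to \<open>b\<close> and restores n from the scratch register, so
  \<open>b\<close> gains a triangular number.\<close>

definition tri :: "nat \<Rightarrow> nat \<Rightarrow> nat \<Rightarrow> com" where
  "tri a b t = LOOP a (SEQ (INC b) (SEQ (move2 a b t) (move t a)))"

lemma exec_move:
  assumes "a \<noteq> b" "R' = R(a := 0, b := R b + R a)"
  shows "exec (move a b) R R'"
  using assms(2)
proof (induction "R a" arbitrary: R)
  case 0
  then show ?case by (auto simp: move_def fun_upd_idem intro!: exec_LOOP_0)
next
  case (Suc n)
  show ?case
    unfolding move_def
    by (rule exec_LOOP_Suc[of R a n, OF Suc.hyps(2)[symmetric] exec_INC[OF refl]],
        fold move_def, rule Suc.hyps(1))
       (use Suc assms(1) in \<open>auto simp: fun_eq_iff\<close>)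
qed

lemma exec_move2:
  assumes "a \<noteq> b" "a \<noteq> c" "b \<noteq> c" "R' = R(a := 0, b := R b + R a, c := R c + R a)"
  shows "exec (move2 a b c) R R'"
  using assms(4)
proof (induction "R a" arbitrary: R)
  case 0
  then show ?case by (auto simp: move2_def fun_upd_idem intro!: exec_LOOP_0)
next
  case (Suc n)
  show ?case
    unfolding move2_def
    by (rule exec_LOOP_Suc[of R a n, OF Suc.hyps(2)[symmetric] exec_SEQ[OF exec_INC[OF refl] exec_INC[OF refl]]],
        fold move2_def, rule Suc.hyps(1))
       (use Suc assms in \<open>auto simp: fun_eq_iff\<close>)
qed

lemma exec_tri:
  assumes "a \<noteq> b" "a \<noteq> t" "b \<noteq> t" "R t = 0" "R' = R(a := 0, b := R b + triangle (R a))"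
  shows "exec (tri a b t) R R'"
  using assms(4,5)
proof (induction "R a" arbitrary: R)
  case 0
  then show ?case by (auto simp: tri_def fun_upd_idem intro!: exec_LOOP_0)
next
  case (Suc n)
  have "exec (SEQ (INC b) (SEQ (move2 a b t) (move t a))) (R(a := n)) (R(a := n, b := R b + Suc n))"
    by (rule exec_SEQ[OF exec_INC[OF refl] exec_SEQ[OF exec_move2[OF _ _ _ refl] exec_move]])
       (use assms(1-3) Suc.prems in \<open>auto simp: fun_eq_iff\<close>)
  then show ?case
    unfolding tri_def
    by (rule exec_LOOP_Suc[of R a n, OF Suc.hyps(2)[symmetric]], fold tri_def, intro Suc.hyps(1))
       (use Suc.prems assms(1-3) in \<open>auto simp: fun_eq_iff Suc.hyps(2)[symmetric]\<close>)
qed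


section \<open>The diagonal machine\<close>

text \<open>For b the code of \<open>Last\<close> and p the code of \<psi>, this is the code of
  \<open>Conj (Up p Last) \<psi>\<close>; 2 and 5 are the tags of \<open>Conj\<close> and of
  \<open>Dist\<close> by \<open>Eps\<close>.\<close>

definition diag_code :: "nat \<Rightarrow> nat \<Rightarrow> nat" where
  "diag_code b p = prod_encode (2, prod_encode (((\<lambda>x. prod_encode (5, x)) ^^ p) b, p))"

text \<open>Register 1 holds the iterate, 2 a copy of the input, 3 an accumulator and 4 the scratch
  register of \<open>tri\<close>; the pairing function is \<open>prod_encode (m, n) = triangle (m + n) + m\<close>.\<close>

definition diag_body :: com where
  "diag_body = SEQ (INC 2) (incs 5 1 (SEQ (tri 1 3 4) (incs 5 3 (move 3 1))))"

definition diag_com :: "nat \<Rightarrow> com" where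
  "diag_com b = incs b 1 (SEQ (LOOP 0 diag_body)
     (SEQ (move2 1 2 3) (SEQ (tri 2 3 4) (incs 2 3 (SEQ (tri 3 0 4) (SEQ (INC 0) (INC 0)))))))"

lemma exec_diag_body:
  assumes "R 3 = 0" "R 4 = 0"
  shows "exec diag_body R (R(1 := prod_encode (5, R 1), 2 := Suc (R 2)))"
proof -
  let ?R1 = "R(2 := Suc (R 2), 1 := R 1 + 5)"
  let ?R2 = "?R1(1 := 0, 3 := triangle (R 1 + 5))"
  let ?R3 = "?R2(3 := triangle (R 1 + 5) + 5)"
  have "exec (move 3 1) ?R3 (R(1 := prod_encode (5, R 1), 2 := Suc (R 2)))"
    by (rule exec_move) (auto simp: fun_eq_iff assms prod_encode_def add.commute)
  then have "exec (incs 5 3 (move 3 1)) ?R2 (R(1 := prod_encode (5, R 1), 2 := Suc (R 2)))"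
    by (intro exec_incs) simp
  moreover have "exec (tri 1 3 4) ?R1 ?R2"
    by (rule exec_tri) (auto simp: fun_eq_iff assms)
  ultimately have "exec (SEQ (tri 1 3 4) (incs 5 3 (move 3 1))) ?R1
      (R(1 := prod_encode (5, R 1), 2 := Suc (R 2)))"
    by (rule exec_SEQ[rotated])
  then show ?thesis
    unfolding diag_body_def
    by (intro exec_SEQ[OF exec_INC[OF refl]] exec_incs) simp
qed

lemma exec_diag_loop:
  assumes "R 3 = 0" "R 4 = 0"
  shows "exec (LOOP 0 diag_body) R
    (R(0 := 0, 1 := ((\<lambda>x. prod_encode (5, x)) ^^ R 0) (R 1), 2 := R 2 + R 0))"
  using assms
proof (induction "R 0" arbitrary: R)
  case 0
  then show ?case by (simp add: exec_LOOP_0 fun_upd_idem)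
next
  case (Suc n)
  let ?R = "R(0 := n, 1 := prod_encode (5, R 1), 2 := Suc (R 2))"
  have "exec diag_body (R(0 := n)) ?R"
    using exec_diag_body[of "R(0 := n)"] Suc.prems by simp
  moreover have "exec (LOOP 0 diag_body) ?R
      (?R(0 := 0, 1 := ((\<lambda>x. prod_encode (5, x)) ^^ n) (prod_encode (5, R 1)), 2 := Suc (R 2) + n))"
    using Suc.hyps(1)[of ?R] Suc.prems by simp
  moreover have "?R(0 := 0, 1 := ((\<lambda>x. prod_encode (5, x)) ^^ n) (prod_encode (5, R 1)), 2 := Suc (R 2) + n)
      = R(0 := 0, 1 := ((\<lambda>x. prod_encode (5, x)) ^^ R 0) (R 1), 2 := R 2 + R 0)"
    by (auto simp: fun_eq_iff funpow_swap1[of "\<lambda>x. prod_encode (5, x)"] simp flip: Suc.hyps(2))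
  ultimately show ?case
    using exec_LOOP_Suc[of R 0 n, OF Suc.hyps(2)[symmetric]] by metis
qed

lemma exec_diag_com:
  "exec (diag_com b) ((\<lambda>_. 0)(0 := p)) ((\<lambda>_. 0)(0 := diag_code b p))"
proof -
  define a where "a = ((\<lambda>x. prod_encode (5, x)) ^^ p) b"
  define Z :: "nat \<Rightarrow> nat" where "Z = (\<lambda>_. 0)"
  let ?R1 = "Z(1 := a, 2 := p)"
  let ?R2 = "Z(2 := p + a, 3 := a)"
  let ?R3 = "Z(3 := prod_encode (a, p))"
  let ?R4 = "Z(3 := prod_encode (a, p) + 2)"
  let ?R5 = "Z(0 := triangle (prod_encode (a, p) + 2))"
  let ?R6 = "Z(0 := diag_code b p)"
  have loop: "exec (LOOP 0 diag_body) (Z(0 := p, 1 := b)) ?R1"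
    using exec_diag_loop[of "Z(0 := p, 1 := b)"]
    by (simp add: Z_def a_def fun_upd_twist[of 0] fun_upd_idem)
  have move: "exec (move2 1 2 3) ?R1 ?R2"
    by (rule exec_move2) (auto simp: fun_eq_iff Z_def)
  have tri2: "exec (tri 2 3 4) ?R2 ?R3"
    by (rule exec_tri) (auto simp: fun_eq_iff Z_def prod_encode_def add.commute)
  have tri3: "exec (tri 3 0 4) ?R4 ?R5"
    by (rule exec_tri) (auto simp: fun_eq_iff Z_def)
  \<comment> \<open>The tag 2 enters the pairing twice: in the argument of \<open>triangle\<close>
    and as the final summand.\<close>
  have "triangle (prod_encode (a, p) + 2) + 2 = diag_code b p"
    by (simp only: diag_code_def a_def prod_encode_def[THEN fun_cong, of "(2, _)"] prod.case add.commute)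
  then have "exec (SEQ (INC 0) (INC 0)) ?R5 ?R6"
    by (intro exec_SEQ[OF exec_INC[OF refl] exec_INC]) (simp add: fun_eq_iff)
  then have "exec (SEQ (tri 3 0 4) (SEQ (INC 0) (INC 0))) ?R4 ?R6"
    by (rule exec_SEQ[OF tri3])
  then have "exec (incs 2 3 (SEQ (tri 3 0 4) (SEQ (INC 0) (INC 0)))) ?R3 ?R6"
    by (intro exec_incs) simp
  note exec_SEQ[OF loop exec_SEQ[OF move exec_SEQ[OF tri2 this]]]
  then show ?thesis
    unfolding diag_com_def by (intro exec_incs) (simp add: Z_def)
qed

text \<open>All halting labels of the decider are merged into the first address behind its code.\<close>

definition relabel :: "nat \<Rightarrow> nat \<Rightarrow> nat \<Rightarrow> nat" where
  "relabel s n l = s + min l n"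

fun relocate :: "nat \<Rightarrow> nat \<Rightarrow> instr \<Rightarrow> instr" where
  "relocate s n (Inc r l) = Inc r (relabel s n l)"
| "relocate s n (Dec r l l') = Dec r (relabel s n l) (relabel s n l')"

text \<open>A step of \<open>P\<close> inside its code is one step of \<open>M\<close>; after
  \<open>P\<close> has halted its configuration is fixed, and \<open>M\<close> takes no
  step.\<close>

lemma reaches_relocate:
  assumes "code_at M s (map (relocate s (length P)) P)"
  shows "reaches M (relabel s (length P) (fst a), snd a)
    (relabel s (length P) (fst ((rm_step P ^^ n) a)), snd ((rm_step P ^^ n) a))"
proof (induction n)
  case 0
  then show ?case by (simp add: reaches_refl)
next
  case (Suc n)
  obtain l R where c: "(rm_step P ^^ n) a = (l, R)" by force
  have "reaches M (relabel s (length P) l, R)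
    (relabel s (length P) (fst (rm_step P (l, R))), snd (rm_step P (l, R)))"
  proof (cases "l < length P")
    case True
    then have "relabel s (length P) l = s + l" by (simp add: relabel_def)
    then show ?thesis
      using True code_at_nth[OF assms, of l]
      by (intro reaches_step) (auto split: instr.split)
  next
    case False
    then show ?thesis by (simp add: reaches_refl)
  qed
  then show ?case using Suc c by (auto intro: reaches_trans)
qed

text \<open>The last instruction jumps to itself while register 0 is zero and otherwise leaves the
  program, which turns the answer 0 into divergence.\<close>

definition diag_machine :: "nat \<Rightarrow> instr list \<Rightarrow> instr list" where
  "diag_machine b P = (let s = size_com (diag_com b); x = s + length P in
     compile (diag_com b) 0 s @ map (relocate s (length P)) P @ [Dec 0 (Suc x) x])"

definition run :: "instr list \<Rightarrow> nat \<Rightarrow> nat \<Rightarrow> nat \<times> (nat \<Rightarrow> nat)" where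
  "run M p n = (rm_step M ^^ n) (0, (\<lambda>_. 0)(0 := p))"

lemma run_0 [simp]: "run M p 0 = (0, (\<lambda>_. 0)(0 := p))"
  by (simp add: run_def)

lemma run_Suc [simp]: "run M p (Suc n) = rm_step M (run M p n)"
  by (simp add: run_def)

lemma fixpoint_run:
  assumes "run M p n = a" "rm_step M a = a"
  shows "run M p (n + m) = a"
  using assms by (induction m) auto

lemma diag_machine_runs_forever_iff:
  assumes P: "rm_computes P (diag_code b p) y"
  shows "(\<forall>n. fst (run (diag_machine b P) p n) < length (diag_machine b P)) \<longleftrightarrow> y = 0"
proof -
  define s where "s = size_com (diag_com b)"
  define x where "x = s + length P"
  define M where "M = diag_machine b P"
  have M: "M = compile (diag_com b) 0 s @ map (relocate s (length P)) P @ [Dec 0 (Suc x) x]"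
    by (simp add: M_def diag_machine_def s_def x_def Let_def)
  then have len: "length M = Suc x"
    by (simp add: x_def s_def)
  have last: "M ! x = Dec 0 (Suc x) x"
    by (simp add: M nth_append x_def s_def)
  have code: "code_at M 0 (compile (diag_com b) 0 s)" "code_at M s (map (relocate s (length P)) P)"
    unfolding code_at_def by (auto simp: M s_def)
  have "reaches M (0, (\<lambda>_. 0)(0 := p)) (s, (\<lambda>_. 0)(0 := diag_code b p))"
    by (rule reaches_compile[OF exec_diag_com code(1)])
  moreover obtain n l R where n: "(rm_step P ^^ n) (0, (\<lambda>_. 0)(0 := diag_code b p)) = (l, R)"
    "length P \<le> l" "R 0 = y"
    using P unfolding rm_computes_def by auto
  have "reaches M (s, (\<lambda>_. 0)(0 := diag_code b p)) (x, R)"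
    using reaches_relocate[OF code(2), of "(0, (\<lambda>_. 0)(0 := diag_code b p))" n] n
    by (simp add: relabel_def x_def)
  ultimately obtain m where m: "run M p m = (x, R)"
    unfolding run_def using reaches_trans reaches_def by metis
  show ?thesis
  proof (cases "y = 0")
    case True
    have "fst (run M p i) < length M" for i
    proof (rule ccontr)
      assume i: "\<not> fst (run M p i) < length M"
      then have "rm_step M (run M p i) = run M p i"
        by (cases "run M p i") simp
      \<comment> \<open>The halted configuration and the loop at \<open>x\<close> are both fixed by
        \<open>rm_step\<close>, so they would coincide at step i + m.\<close>
      then have "run M p (i + m) = run M p i"
        using fixpoint_run by blast
      moreover have "run M p (m + i) = (x, R)"
        using m last len n(3) True by (intro fixpoint_run) simp_all
      ultimately show False using i len by (simp add: add.commute)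
    qed
    then show ?thesis using True by (simp add: M_def)
  next
    case False
    then have "fst (run M p (Suc m)) = length M"
      using m last len n(3) by simp
    then show ?thesis using False unfolding M_def by (metis less_irrefl)
  qed
qed


section \<open>Describing a run of a machine\<close>

text \<open>
  Let \<open>L\<close> be the number of instructions and \<open>N\<close> a bound on the registers. Block 0 holds \<open>p + 1\<close> for the
  input \<open>p\<close>. From block 1 on, frames of \<open>N + 1\<close> blocks hold \<open>pc + 1\<close>, followed by \<open>R r + L + 1\<close> for
  the registers \<open>r < N\<close>. Running configurations have \<open>pc + 1 \<le> L\<close>, so a register block is never mistaken
  for the beginning of a frame.
\<close>

text \<open>If \<open>c\<close> holds at the beginning of a frame, the next frame has program counter \<open>l\<close> and the same
  registers, except that register \<open>r\<close> changes by \<open>b - a\<close>.\<close>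

definition transition_fm :: "nat \<Rightarrow> nat \<Rightarrow> nat xtn \<Rightarrow> nat \<Rightarrow> nat \<Rightarrow> nat \<Rightarrow> nat \<Rightarrow> nat xtn" where
  "transition_fm L N c l r a b =
     Imp (AtStart c)
      (if l < L
       then Conj (AtStart (Fwd (Suc N) (Up l Last)))
         (Conjs (map (\<lambda>r'.
            Iff (Fwd (Suc r') (Up (if r' = r then a else 0) More))
                (Fwd (Suc N + Suc r') (Up (if r' = r then b else 0) More))) [0..<N]))
       else Neg Truth)"

text \<open>A register block holds \<open>R r + L + 1\<close>, so \<open>More\<close> at offset
  \<open>Suc L\<close> tests whether the register is nonzero.\<close>

definition instr_fm :: "nat \<Rightarrow> nat \<Rightarrow> nat \<Rightarrow> instr \<Rightarrow> nat xtn" where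
  "instr_fm L N q i = (case i of
     Inc r l \<Rightarrow> transition_fm L N (Up q Last) l r 0 1
   | Dec r l l' \<Rightarrow>
       Conj (transition_fm L N (Conj (Up q Last) (Fwd (Suc r) (Up (Suc L) More))) l r 1 0)
            (transition_fm L N (Conj (Up q Last) (Neg (Fwd (Suc r) (Up (Suc L) More)))) l' r 0 0))"

text \<open>The clause for block 0 adds L to the input block to obtain register 0, so the formula is
  independent of the input. The instruction rules skip block 0, whose counter could pass for a
  program counter.\<close>

definition run_fm :: "instr list \<Rightarrow> nat \<Rightarrow> nat xtn" where
  "run_fm M N = (let L = length M in
     Conj (Fwd 1 Last)
    (Conj (Conjs (map (\<lambda>r. Fwd (Suc (Suc r)) (Up L Last)) [1..<N]))
     (Always
       (Conj (Imp (Dist More Eps) More)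
       (Conj (Imp (Neg (Dist Truth MinusOne)) (Iff More (Fwd 2 (Up L More))))
             (Imp (Dist Truth MinusOne) (Conjs (map (\<lambda>q. instr_fm L N q (M ! q)) [0..<L]))))))))"

lemma atoms_run_fm: "atoms (run_fm M N) = {}"
  by (auto simp: run_fm_def instr_fm_def transition_fm_def atoms_derived Let_def split: instr.split)

text \<open>Demanding \<open>l < L\<close> makes every jump out of the program contradictory, so
  only infinite runs are described.\<close>

definition transition_ok ::
  "nat \<Rightarrow> nat \<Rightarrow> (nat \<Rightarrow> nat \<Rightarrow> bool) \<Rightarrow> nat \<Rightarrow> nat \<Rightarrow> nat \<Rightarrow> nat \<Rightarrow> nat \<Rightarrow> bool" where
  "transition_ok L N h v l r a b \<longleftrightarrow>
     l < L \<and> h (v + Suc N) l \<and> \<not> h (v + Suc N) (Suc l) \<and>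
     (\<forall>r' < N. \<forall>k. h (v + Suc r') (k + (if r' = r then a else 0)) \<longleftrightarrow>
                    h (v + Suc N + Suc r') (k + (if r' = r then b else 0)))"

definition instr_ok :: "nat \<Rightarrow> nat \<Rightarrow> (nat \<Rightarrow> nat \<Rightarrow> bool) \<Rightarrow> nat \<Rightarrow> instr \<Rightarrow> bool" where
  "instr_ok L N h v i = (case i of
     Inc r l \<Rightarrow> transition_ok L N h v l r 0 1
   | Dec r l l' \<Rightarrow> if h (v + Suc r) (Suc L) then transition_ok L N h v l r 1 0
                   else transition_ok L N h v l' r 0 0)"

definition describes_run :: "instr list \<Rightarrow> nat \<Rightarrow> (nat \<Rightarrow> nat \<Rightarrow> bool) \<Rightarrow> bool" where
  "describes_run M N h \<longleftrightarrow> (let L = length M in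
     h 1 0 \<and> \<not> h 1 1 \<and>
     (\<forall>r. 1 \<le> r \<and> r < N \<longrightarrow> h (Suc (Suc r)) L \<and> \<not> h (Suc (Suc r)) (Suc L)) \<and>
     (\<forall>v k. h v (Suc k) \<longrightarrow> h v k) \<and>
     (\<forall>k. h 0 k \<longleftrightarrow> h 2 (k + L)) \<and>
     (\<forall>v > 0. \<forall>q < L. h v q \<and> \<not> h v (Suc q) \<longrightarrow> instr_ok L N h v (M ! q)))"

context infinitesimal
begin

text \<open>The \<open>AtStart\<close> parts do not depend on the offset k, while the equivalences
  are read at every k; together these compare whole counters.\<close>

lemma sat_transition_fm:
  "(\<forall>k. sat e S (pt v k) (transition_fm L N c l r a b)) \<longleftrightarrow>
   (sat e S (pt v 0) c \<longrightarrow> transition_ok L N (more S) v l r a b)"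
  by (auto simp: transition_fm_def transition_ok_def add.assoc)

lemma sat_instr_fm:
  "(\<forall>k. sat e S (pt v k) (instr_fm L N q i)) \<longleftrightarrow>
   (more S v q \<and> \<not> more S v (Suc q) \<longrightarrow> instr_ok L N (more S) v i)"
  by (cases i) (auto simp: instr_fm_def instr_ok_def all_conj_distrib sat_transition_fm)

lemma sat_run_fm:
  "sat e S (pt 0 0) (run_fm M N) \<longleftrightarrow> describes_run M N (more S)"
proof -
  have "(\<forall>v k. v \<noteq> 0 \<longrightarrow> (\<forall>q<length M. sat e S (pt v k) (instr_fm (length M) N q (M ! q)))) \<longleftrightarrow>
    (\<forall>v>0. \<forall>q<length M. more S v q \<and> \<not> more S v (Suc q) \<longrightarrow>
       instr_ok (length M) N (more S) v (M ! q))"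
    unfolding sat_instr_fm[symmetric] by blast
  then show ?thesis
    by (auto simp: run_fm_def describes_run_def Let_def all_conj_distrib numeral_2_eq_2)
qed

end

section \<open>Frames and the actual run\<close>

definition frame :: "nat \<Rightarrow> nat \<Rightarrow> (nat \<Rightarrow> nat \<Rightarrow> bool) \<Rightarrow> nat \<Rightarrow> nat \<times> (nat \<Rightarrow> nat) \<Rightarrow> bool" where
  "frame L N h v a \<longleftrightarrow>
     (\<forall>k. h v k \<longleftrightarrow> k < Suc (fst a)) \<and>
     (\<forall>r < N. \<forall>k. h (v + Suc r) k \<longleftrightarrow> k < snd a r + Suc L)"

primrec reg :: "instr \<Rightarrow> nat" where
  "reg (Inc r l) = r"
| "reg (Dec r l l') = r"

lemma down_closed_less_iff:
  assumes "\<And>k. g (Suc k) \<Longrightarrow> g k" "g n" "\<not> g (Suc n)"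
  shows "g k \<longleftrightarrow> k < Suc n"
proof -
  have down: "g j" if "g i" "j \<le> i" for i j :: nat
    using that(2,1) by (induction rule: inc_induct) (use assms(1) in auto)
  show ?thesis
    using down[of n k] down[of k "Suc n"] assms(2,3) by (meson not_less_eq_eq not_less)
qed

lemma frame_step:
  assumes down: "\<And>v k. h v (Suc k) \<Longrightarrow> h v k"
    and rules: "\<And>q. q < length M \<Longrightarrow> h v q \<and> \<not> h v (Suc q) \<Longrightarrow> instr_ok (length M) N h v (M ! q)"
    and regs: "\<And>i. i \<in> set M \<Longrightarrow> reg i < N"
    and fr: "frame (length M) N h v a" and pc: "fst a < length M"
  shows "fst (rm_step M a) < length M" "frame (length M) N h (v + Suc N) (rm_step M a)"
proof -
  obtain q R where a: "a = (q, R)" by force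
  have q: "q < length M" using pc a by simp
  have ok: "instr_ok (length M) N h v (M ! q)"
    using fr q rules[of q] by (simp add: a frame_def)
  have old: "h (v + Suc r) k \<longleftrightarrow> k < R r + Suc (length M)" if "r < N" for r k
    using fr that by (simp add: a frame_def)
  have r: "reg (M ! q) < N" using regs q by simp
  have new: "fst (l, R') < length M \<and> frame (length M) N h (v + Suc N) (l, R')"
    if t: "transition_ok (length M) N h v l s x y"
      and R': "\<And>r k. r < N \<Longrightarrow> h (v + Suc N + Suc r) k \<longleftrightarrow> k < R' r + Suc (length M)" for l R' s x y
  proof -
    have "h (v + Suc N) k \<longleftrightarrow> k < Suc l" for k
      using t down by (intro down_closed_less_iff) (auto simp: transition_ok_def)
    then show ?thesis using t R' by (auto simp: frame_def transition_ok_def)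
  qed
  have "fst (rm_step M a) < length M \<and> frame (length M) N h (v + Suc N) (rm_step M a)"
  proof (cases "M ! q")
    case (Inc s l)
    have t: "transition_ok (length M) N h v l s 0 1"
      using ok by (simp add: Inc instr_ok_def)
    have "h (v + Suc N + Suc r') k \<longleftrightarrow> k < (R(s := Suc (R s))) r' + Suc (length M)" if "r' < N" for r' k
    proof (cases "r' = s")
      case True
      then have *: "h (v + Suc N + Suc r') (Suc j) \<longleftrightarrow> j < R s + Suc (length M)" for j
        using t that old[of r' j] by (simp add: transition_ok_def)
      show ?thesis
      proof (cases k)
        \<comment> \<open>The shifted equivalence says nothing about offset 0 of the new block;
          downward closure supplies it.\<close>
        case 0
        then show ?thesis using *[of 0] down[of "v + Suc N + Suc r'" 0] True by simp
      next
        case (Suc j)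
        then show ?thesis using *[of j] True by simp
      qed
    next
      case False
      then show ?thesis
        using t that old[of r' k] by (simp add: transition_ok_def)
    qed
    from new[OF t this] show ?thesis
      using q by (simp add: a Inc fun_upd_def)
  next
    case (Dec s l l')
    have s: "h (v + Suc s) (Suc (length M)) \<longleftrightarrow> R s \<noteq> 0"
      using r old[of s "Suc (length M)"] by (simp add: Dec)
    show ?thesis
    proof (cases "R s = 0")
      case True
      then have t: "transition_ok (length M) N h v l' s 0 0"
        using ok s by (simp add: Dec instr_ok_def)
      have "h (v + Suc N + Suc r') k \<longleftrightarrow> k < R r' + Suc (length M)" if "r' < N" for r' k
        using t that old[of r' k] by (simp add: transition_ok_def split: if_splits)
      from new[OF t this] show ?thesis
        using q True by (simp add: a Dec)
    next
      case False
      then have t: "transition_ok (length M) N h v l s 1 0"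
        using ok s by (simp add: Dec instr_ok_def)
      have "h (v + Suc N + Suc r') k \<longleftrightarrow> k < (R(s := R s - 1)) r' + Suc (length M)" if "r' < N" for r' k
        using t that old[of r' k] old[of r' "Suc k"] False
        by (cases "r' = s") (auto simp: transition_ok_def)
      from new[OF t this] show ?thesis
        using q False by (simp add: a Dec fun_upd_def)
    qed
  qed
  then show "fst (rm_step M a) < length M" "frame (length M) N h (v + Suc N) (rm_step M a)"
    by auto
qed

lemma describes_run_imp_nonhalting:
  assumes h: "describes_run M N h" and input: "h 0 p" "\<not> h 0 (Suc p)"
    and regs: "\<And>i. i \<in> set M \<Longrightarrow> reg i < N" and "M \<noteq> []"
  shows "fst (run M p n) < length M"
proof -
  have down: "h v (Suc k) \<Longrightarrow> h v k" for v k
    using h by (auto simp: describes_run_def Let_def)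
  have cut: "h v k \<longleftrightarrow> k < Suc m" if "h v m" "\<not> h v (Suc m)" for v m k
    using that down by (intro down_closed_less_iff) auto
  have "fst (run M p n) < length M \<and> frame (length M) N h (1 + Suc N * n) (run M p n)"
  proof (induction n)
    case 0
    have "h (1 + Suc r) k \<longleftrightarrow> k < ((\<lambda>_. 0)(0 := p)) r + Suc (length M)" if "r < N" for r k
    proof (cases "r = 0")
      case True
      have "h 2 (p + length M)" "\<not> h 2 (Suc p + length M)"
        using h input by (auto simp: describes_run_def Let_def simp del: add_Suc)
      then show ?thesis using cut[of 2 "p + length M" k] True by (simp add: numeral_2_eq_2)
    next
      case False
      then show ?thesis
        using h that cut[of "Suc (Suc r)" "length M" k] by (simp add: describes_run_def Let_def)
    qed
    then show ?case
      using h cut[of 1 0] \<open>M \<noteq> []\<close> by (simp add: frame_def describes_run_def Let_def)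
  next
    case (Suc n)
    have "instr_ok (length M) N h (1 + Suc N * n) (M ! q)"
      if "q < length M" "h (1 + Suc N * n) q \<and> \<not> h (1 + Suc N * n) (Suc q)" for q
      using h that by (simp add: describes_run_def Let_def)
    from frame_step[OF down this regs] Suc show ?case
      by (simp add: algebra_simps)
  qed
  then show ?thesis ..
qed

definition run_counter :: "instr list \<Rightarrow> nat \<Rightarrow> nat \<Rightarrow> nat \<Rightarrow> nat" where
  "run_counter M N p v = (if v = 0 then Suc p else
     let a = run M p ((v - 1) div Suc N); i = (v - 1) mod Suc N
     in if i = 0 then Suc (fst a) else snd a (i - 1) + Suc (length M))"

lemma run_counter_pos: "0 < run_counter M N p v"
  by (simp add: run_counter_def Let_def)

lemma run_counter_pc: "run_counter M N p (Suc (Suc N * n)) = Suc (fst (run M p n))"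
  by (simp add: run_counter_def Let_def del: mult_Suc)

lemma run_counter_reg:
  assumes "r < N"
  shows "run_counter M N p (Suc (Suc N * n) + Suc r) = snd (run M p n) r + Suc (length M)"
proof -
  have "(Suc N * n + Suc r) div Suc N = n" "(Suc N * n + Suc r) mod Suc N = Suc r"
    using assms by (simp_all only: div_mult_self4 mod_mult_self4 div_less mod_less Suc_less_eq)
  then show ?thesis
    by (simp add: run_counter_def Let_def del: mult_Suc)
qed

lemma nonhalting_imp_describes_run:
  assumes run: "\<And>n. fst (run M p n) < length M"
    and regs: "\<And>i. i \<in> set M \<Longrightarrow> reg i < N" and "M \<noteq> []"
  shows "describes_run M N (\<lambda>v k. k < run_counter M N p v)"
proof -
  let ?h = "\<lambda>v k. k < run_counter M N p v"
  let ?L = "length M"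
  have "0 < N" using regs[of "hd M"] \<open>M \<noteq> []\<close> by force
  have pc0: "run_counter M N p 1 = 1"
    using run_counter_pc[of M N p 0] by simp
  have reg0: "run_counter M N p (Suc (Suc r)) = (if r = 0 then p else 0) + Suc ?L" if "r < N" for r
    using run_counter_reg[of r N M p 0] that by simp
  have "instr_ok ?L N ?h v (M ! q)" if v: "0 < v" and q: "q < ?L" and "?h v q \<and> \<not> ?h v (Suc q)" for v q
  proof -
    have cv: "run_counter M N p v = Suc q"
      using that by simp
    define n where "n = (v - 1) div Suc N"
    \<comment> \<open>A register block has a counter of at least L + 1, whereas here it is
      \<open>Suc q\<close>, at most L.\<close>
    have "(v - 1) mod Suc N = 0"
      using cv q v by (auto simp: run_counter_def Let_def split: if_splits)
    then have "v = Suc (Suc N * n)"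
      using v mult_div_mod_eq[of "Suc N" "v - 1"] unfolding n_def by simp
    obtain R where R: "run M p n = (q, R)"
      using cv run_counter_pc[of M N p n] \<open>v = _\<close> by (cases "run M p n") simp
    have old: "run_counter M N p (v + Suc r) = R r + Suc ?L" if "r < N" for r
      using run_counter_reg[OF that, of M p n] R \<open>v = _\<close> by simp
    have v': "v + Suc N = Suc (Suc N * Suc n)"
      using \<open>v = _\<close> by simp
    have new_pc: "run_counter M N p (v + Suc N) = Suc (fst (rm_step M (q, R)))"
      using run_counter_pc[of M N p "Suc n"] R unfolding v' by (simp del: mult_Suc_right)
    have new: "run_counter M N p (v + Suc N + Suc r) = snd (rm_step M (q, R)) r + Suc ?L"
      if "r < N" for r
      using run_counter_reg[OF that, of M p "Suc n"] R unfolding v' by (simp del: mult_Suc_right)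
    have next_pc: "fst (rm_step M (q, R)) < ?L"
      using run[of "Suc n"] R by simp
    have r: "reg (M ! q) < N" using regs q by simp
    show ?thesis
      using old[of "reg (M ! q)"] r next_pc q
      by (cases "M ! q")
        (auto simp: instr_ok_def transition_ok_def new_pc new old simp del: add_Suc_right)
  qed
  then show ?thesis
    using pc0 reg0 \<open>0 < N\<close>
    by (auto simp: describes_run_def Let_def run_counter_def[of _ _ _ 0] numeral_2_eq_2)
qed

section \<open>The reduction and the diagonal argument\<close>

definition bound_regs :: "instr list \<Rightarrow> nat" where
  "bound_regs M = Suc (\<Sum>i\<leftarrow>M. reg i)"

lemma reg_less_bound_regs: "i \<in> set M \<Longrightarrow> reg i < bound_regs M"
  using member_le_sum_list[of "reg i" "map reg M"] by (simp add: bound_regs_def)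

lemma (in infinitesimal) satisfiable_iff_nonhalting:
  assumes "M \<noteq> []"
  shows "xtn_satisfiable e AP (Conj (Up p Last) (run_fm M (bound_regs M))) \<longleftrightarrow>
    (\<forall>n. fst (run M p n) < length M)"
proof -
  let ?N = "bound_regs M"
  have sat: "sat e S 0 (Conj (Up p Last) (run_fm M ?N)) \<longleftrightarrow>
      more S 0 p \<and> \<not> more S 0 (Suc p) \<and> describes_run M ?N (more S)" for S
    using sat_run_fm sat_Up[of S 0 0 p Last] by (simp add: pt_0)
  show ?thesis
  proof
    assume "xtn_satisfiable e AP (Conj (Up p Last) (run_fm M ?N))"
    then obtain S where "more S 0 p" "\<not> more S 0 (Suc p)" "describes_run M ?N (more S)"
      unfolding xtn_satisfiable_def sat by auto
    then show "\<forall>n. fst (run M p n) < length M"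
      using describes_run_imp_nonhalting reg_less_bound_regs assms by blast
  next
    assume *: "\<forall>n. fst (run M p n) < length M"
    let ?S = "counter_struct (run_counter M ?N p)"
    have more: "more ?S = (\<lambda>v k. k < run_counter M ?N p v)"
      by (intro ext more_counter_struct run_counter_pos)
    have "sat e ?S 0 (Conj (Up p Last) (run_fm M ?N))"
      unfolding sat more
      using nonhalting_imp_describes_run[OF _ reg_less_bound_regs assms] *
      by (simp add: run_counter_def[of _ _ _ 0])
    then show "xtn_satisfiable e AP (Conj (Up p Last) (run_fm M ?N))"
      unfolding xtn_satisfiable_def using is_xtn_struct_counter_struct run_counter_pos by blast
  qed
qed

lemma xtn_code_Up: "xtn_code (Up n \<phi>) = ((\<lambda>x. prod_encode (5, x)) ^^ n) (xtn_code \<phi>)"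
  by (induction n) (simp_all add: Up_def)

theorem theorem1:
  fixes \<epsilon> :: "'a::{linordered_field, real_algebra_1}" and AP :: "nat set"
  assumes "0 < \<epsilon>" and "\<forall>r::real. 0 < r \<longrightarrow> \<epsilon> < of_real r"
    and "finite AP"
  shows "\<not> decidable_problem xtn_code {\<phi>. atoms \<phi> \<subseteq> AP} (xtn_satisfiable \<epsilon> AP)"
proof
  interpret infinitesimal \<epsilon>
  proof
    fix n :: nat
    show "of_nat n * \<epsilon> < 1"
    proof (cases "n = 0")
      case False
      have "of_nat n * \<epsilon> < of_nat n * of_real (1 / real n)"
        using assms(2) False by (intro mult_strict_left_mono) auto
      also have "\<dots> = of_real (real n * (1 / real n))"
        by (simp only: of_real_mult of_real_of_nat_eq)
      also have "\<dots> = 1" using False by simp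
      finally show ?thesis .
    qed simp
  qed (rule assms(1))
  assume "decidable_problem xtn_code {\<phi>. atoms \<phi> \<subseteq> AP} (xtn_satisfiable \<epsilon> AP)"
  then obtain P where P: "\<And>\<phi>. atoms \<phi> \<subseteq> AP \<Longrightarrow>
      rm_computes P (xtn_code \<phi>) (if xtn_satisfiable \<epsilon> AP \<phi> then 1 else 0)"
    unfolding decidable_problem_def by blast
  define M where "M = diag_machine (xtn_code Last) P"
  define \<psi> where "\<psi> = run_fm M (bound_regs M)"
  define p where "p = xtn_code \<psi>"
  define \<phi> where "\<phi> = Conj (Up p Last) \<psi>"
  \<comment> \<open>Without atoms, the diagonal formula is an instance for every \<open>AP\<close>,
    even the empty one.\<close>
  have "atoms \<phi> \<subseteq> AP"
    by (auto simp: \<phi>_def \<psi>_def atoms_run_fm atoms_derived)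
  moreover have "xtn_code \<phi> = diag_code (xtn_code Last) p"
    by (simp add: \<phi>_def diag_code_def xtn_code_Up p_def)
  ultimately have "(\<forall>n. fst (run M p n) < length M) \<longleftrightarrow> \<not> xtn_satisfiable \<epsilon> AP \<phi>"
    using diag_machine_runs_forever_iff P unfolding M_def by fastforce
  moreover have "M \<noteq> []"
    by (simp add: M_def diag_machine_def Let_def)
  ultimately show False
    using satisfiable_iff_nonhalting unfolding \<phi>_def \<psi>_def by blast
qed

end
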